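(* Fix $\sigma^2 > 0$ (with $\sigma>0$), a constant $c \in (0,1)$, and a sequence $\delta_n \in [0,1]$ with $\delta_n \to 0$. For $\theta \in \mathbb{R}$ let $P_\theta = \mathsf{N}(\theta,\sigma^2)$ and let $P_\theta^n$ be the law of $n$ i.i.d. observations $X_1,\dots,X_n$ from $P_\theta$. For each $n$ define $$\Theta_n = \left\{\theta \in \mathbb{R} \;\middle|\; \frac{2\sigma}{\sqrt n} \le |\theta| \le \frac{\sigma}{\sqrt n}\sqrt{c \log \frac{1}{\delta_n}}\right\}.$$ Let $\widehat\theta_n : \mathbb{R}^n \to \mathbb{R}$ be a sequence of estimators satisfying $$P_0^n\left(|\widehat\theta_n(X_1,\dots,X_n)| \ge \frac{\sigma}{\sqrt n}\right) \le \delta_n \quad \text{for all } n.$$ Then $$\liminf_{n\to\infty}\ \inf_{\theta \in \Theta_n} P_\theta^n\left(\sqrt n\,|\widehat\theta_n(X_1,\dots,X_n) - \theta| \ge \sigma\right) = 1.$$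
   Context: $P_0^n$ is $P_\theta^n$ with $\theta = 0$. Estimators are measurable functions. If $\delta_n = 0$, then $\log(1/\delta_n) = +\infty$, so the upper constraint in $\Theta_n$ is vacuous. Since $\delta_n\to 0$, $\Theta_n$ is nonempty for all large $n$. *)

theory Defs
  imports "HOL-Probability.Probability"
begin

(* The second argument of normal_density is the standard deviation, not the variance. *)
definition normal_law :: "real \<Rightarrow> real \<Rightarrow> real measure" where
  "normal_law \<sigma> \<theta> = density lborel (\<lambda>x. ennreal (normal_density \<theta> \<sigma> x))"

(* Points of R^n are functions on {..<n}, extended by undefined outside. *)
definition normal_sample_law :: "real \<Rightarrow> real \<Rightarrow> nat \<Rightarrow> (nat \<Rightarrow> real) measure" where
  "normal_sample_law \<sigma> \<theta> n = Pi\<^sub>M {..<n} (\<lambda>_. normal_law \<sigma> \<theta>)"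

definition estimator :: "nat \<Rightarrow> ((nat \<Rightarrow> real) \<Rightarrow> real) \<Rightarrow> bool" where
  "estimator n t \<longleftrightarrow> t \<in> borel_measurable (Pi\<^sub>M {..<n} (\<lambda>_. (borel :: real measure)))"

(* For d = 0 one has log (1/d) = +infinity, so the upper bound is void; in HOL, 1/0 = 0,
   hence the guard. *)
definition parameter_set :: "real \<Rightarrow> real \<Rightarrow> real \<Rightarrow> nat \<Rightarrow> real set" where
  "parameter_set \<sigma> c d n =
     {\<theta>. 2 * \<sigma> / sqrt (real n) \<le> \<bar>\<theta>\<bar> \<and>
          (d \<noteq> 0 \<longrightarrow> \<bar>\<theta>\<bar> \<le> \<sigma> / sqrt (real n) * sqrt (c * ln (1 / d)))}"

end

(* Write P_\<theta> for the law of the sample. If the estimator is within \<sigma>/\<surd>n of some \<theta> with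
   |\<theta>| \<ge> 2\<sigma>/\<surd>n, then it is at least \<sigma>/\<surd>n in absolute value; let A be the former event, so
   P_0(A) \<le> \<delta>. By the Cauchy-Schwarz inequality applied to the likelihood ratio L = dP_\<theta>/dP_0,
   P_\<theta>(A)^2 \<le> P_0(A) E_0[L^2] \<le> \<delta> exp(n \<theta>^2/\<sigma>^2) \<le> \<delta>^(1-c) on the parameter set,
   which tends to 0 uniformly in \<theta>. *)

theory Submission
  imports Defs
begin

text \<open>A product of sigma-finite measures is determined by its values on boxes, and on a box
  the integral of the product density factorises. This gives the likelihood ratio of a sample as the
  product of those of its entries.\<close>

lemma density_PiM:
  assumes "product_sigma_finite M" and "product_sigma_finite (\<lambda>i. density (M i) (f i))"
    and "finite I" and f: "\<And>i. i \<in> I \<Longrightarrow> f i \<in> borel_measurable (M i)"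
  shows "density (Pi\<^sub>M I M) (\<lambda>x. \<Prod>i\<in>I. f i (x i)) = Pi\<^sub>M I (\<lambda>i. density (M i) (f i))"
proof (rule product_sigma_finite.PiM_eqI)
  show "sets (density (Pi\<^sub>M I M) (\<lambda>x. \<Prod>i\<in>I. f i (x i))) = sets (Pi\<^sub>M I (\<lambda>i. density (M i) (f i)))"
    by (simp cong: sets_PiM_cong)
next
  fix A assume "\<And>i. i \<in> I \<Longrightarrow> A i \<in> sets (density (M i) (f i))"
  then have A: "\<And>i. i \<in> I \<Longrightarrow> A i \<in> sets (M i)" by simp
  have [measurable]: "(\<lambda>x. \<Prod>i\<in>I. f i (x i)) \<in> borel_measurable (Pi\<^sub>M I M)"
    using f by measurable
  have "emeasure (density (Pi\<^sub>M I M) (\<lambda>x. \<Prod>i\<in>I. f i (x i))) (Pi\<^sub>E I A)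
    = (\<integral>\<^sup>+x. (\<Prod>i\<in>I. f i (x i)) * indicator (Pi\<^sub>E I A) x \<partial>Pi\<^sub>M I M)"
    using A \<open>finite I\<close> by (intro emeasure_density sets_PiM_I_finite) auto
  also have "\<dots> = (\<integral>\<^sup>+x. (\<Prod>i\<in>I. f i (x i) * indicator (A i) (x i)) \<partial>Pi\<^sub>M I M)"
  proof (rule nn_integral_cong)
    fix x assume "x \<in> space (Pi\<^sub>M I M)"
    then have "indicator (Pi\<^sub>E I A) x = (\<Prod>i\<in>I. indicator (A i) (x i) :: ennreal)"
      using \<open>finite I\<close> by (auto simp: space_PiM PiE_iff indicator_def prod.neutral)
    then show "(\<Prod>i\<in>I. f i (x i)) * indicator (Pi\<^sub>E I A) x = (\<Prod>i\<in>I. f i (x i) * indicator (A i) (x i))"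
      by (simp add: prod.distrib)
  qed
  also have "\<dots> = (\<Prod>i\<in>I. \<integral>\<^sup>+x. f i x * indicator (A i) x \<partial>M i)"
    using assms(1) \<open>finite I\<close> f A by (intro product_sigma_finite.product_nn_integral_prod) auto
  also have "\<dots> = (\<Prod>i\<in>I. emeasure (density (M i) (f i)) (A i))"
    using f A by (intro prod.cong) (auto simp: emeasure_density)
  finally show "emeasure (density (Pi\<^sub>M I M) (\<lambda>x. \<Prod>i\<in>I. f i (x i))) (Pi\<^sub>E I A)
    = (\<Prod>i\<in>I. emeasure (density (M i) (f i)) (A i))" .
qed (use assms in auto)

text \<open>Cauchy-Schwarz for the product of \<open>f\<close> with the indicator of
  \<open>A\<close>, which is its own square. The right-hand side may be infinite.\<close>

lemma emeasure_density_power2_le: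
  assumes f [measurable]: "f \<in> borel_measurable M" and A [measurable]: "A \<in> sets M"
  shows "(emeasure (density M f) A)\<^sup>2 \<le> emeasure M A * (\<integral>\<^sup>+x. (f x)\<^sup>2 \<partial>M)"
proof -
  have "(emeasure (density M f) A)\<^sup>2 = (\<integral>\<^sup>+x. indicator A x * f x \<partial>M)\<^sup>2"
    by (simp add: emeasure_density mult.commute)
  also have "\<dots> \<le> (\<integral>\<^sup>+x. (indicator A x)\<^sup>2 \<partial>M) * (\<integral>\<^sup>+x. (f x)\<^sup>2 \<partial>M)"
    by (rule Cauchy_Schwarz_nn_integral) auto
  also have "(\<integral>\<^sup>+x. (indicator A x)\<^sup>2 \<partial>M) = (\<integral>\<^sup>+x. indicator A x \<partial>M)"
    by (intro nn_integral_cong) (auto simp: indicator_def)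
  finally show ?thesis by simp
qed

lemma prob_space_normal_law: "\<sigma> > 0 \<Longrightarrow> prob_space (normal_law \<sigma> \<theta>)"
  unfolding normal_law_def by (rule prob_space_normal_density)

lemma prob_space_normal_sample_law: "\<sigma> > 0 \<Longrightarrow> prob_space (normal_sample_law \<sigma> \<theta> n)"
  unfolding normal_sample_law_def by (intro prob_space_PiM prob_space_normal_law)

lemma sets_normal_sample_law:
  "sets (normal_sample_law \<sigma> \<theta> n) = sets (Pi\<^sub>M {..<n} (\<lambda>_. borel :: real measure))"
  unfolding normal_sample_law_def normal_law_def by (intro sets_PiM_cong) auto

text \<open>The Radon-Nikodym derivative of N(\<theta>, \<sigma>^2) with respect to N(0,
  \<sigma>^2), with the quotient of the two densities already simplified.\<close>

definition normal_likelihood_ratio :: "real \<Rightarrow> real \<Rightarrow> real \<Rightarrow> real" where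
  "normal_likelihood_ratio \<sigma> \<theta> x = exp (\<theta> * x / \<sigma>\<^sup>2 - \<theta>\<^sup>2 / (2 * \<sigma>\<^sup>2))"

lemma measurable_normal_likelihood_ratio [measurable]:
  "normal_likelihood_ratio \<sigma> \<theta> \<in> borel_measurable borel"
  unfolding normal_likelihood_ratio_def by measurable

text \<open>The two laws share \<sigma>, so the normalising constants and the quadratic terms in x
  cancel in the quotient, leaving an exponent affine in x.\<close>

lemma normal_law_eq_density:
  assumes "\<sigma> > 0"
  shows "normal_law \<sigma> \<theta> = density (normal_law \<sigma> 0) (normal_likelihood_ratio \<sigma> \<theta>)"
proof -
  have "normal_density \<theta> \<sigma> x = normal_density 0 \<sigma> x * normal_likelihood_ratio \<sigma> \<theta> x" for x
  proof -
    have "-(x - \<theta>)\<^sup>2 / (2 * \<sigma>\<^sup>2) = -(x - 0)\<^sup>2 / (2 * \<sigma>\<^sup>2) + (\<theta> * x / \<sigma>\<^sup>2 - \<theta>\<^sup>2 / (2 * \<sigma>\<^sup>2))"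
      using assms by (simp add: field_simps power2_eq_square)
    then show ?thesis
      unfolding normal_density_def normal_likelihood_ratio_def by (simp only: exp_add mult.assoc)
  qed
  then show ?thesis
    unfolding normal_law_def
    by (subst density_density_eq) (auto simp: ennreal_mult' normal_density_nonneg)
qed

(* The square of the likelihood ratio at \<theta> is a multiple of the one at 2\<theta>, whose mean is 1. *)
lemma nn_integral_normal_likelihood_ratio_power2:
  assumes "\<sigma> > 0"
  shows "(\<integral>\<^sup>+x. (ennreal (normal_likelihood_ratio \<sigma> \<theta> x))\<^sup>2 \<partial>normal_law \<sigma> 0) = exp (\<theta>\<^sup>2 / \<sigma>\<^sup>2)"
proof -
  have [measurable_cong]: "sets (normal_law \<sigma> 0) = sets borel"
    by (simp add: normal_law_def)
  have "(normal_likelihood_ratio \<sigma> \<theta> x)\<^sup>2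
      = exp (\<theta>\<^sup>2 / \<sigma>\<^sup>2) * normal_likelihood_ratio \<sigma> (2 * \<theta>) x" for x
    unfolding normal_likelihood_ratio_def power2_eq_square exp_add[symmetric]
    using assms by (simp add: field_simps)
  then have "(\<integral>\<^sup>+x. (ennreal (normal_likelihood_ratio \<sigma> \<theta> x))\<^sup>2 \<partial>normal_law \<sigma> 0)
    = (\<integral>\<^sup>+x. ennreal (exp (\<theta>\<^sup>2 / \<sigma>\<^sup>2)) * ennreal (normal_likelihood_ratio \<sigma> (2 * \<theta>) x) \<partial>normal_law \<sigma> 0)"
    by (intro nn_integral_cong)
      (simp add: ennreal_power ennreal_mult'[symmetric] normal_likelihood_ratio_def)
  also have "\<dots> = exp (\<theta>\<^sup>2 / \<sigma>\<^sup>2) * (\<integral>\<^sup>+x. normal_likelihood_ratio \<sigma> (2 * \<theta>) x \<partial>normal_law \<sigma> 0)"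
    by (rule nn_integral_cmult) measurable
  \<comment> \<open>By change of density, this integral is the total mass of the normal law with
    mean 2\<theta>.\<close>
  also have "(\<integral>\<^sup>+x. normal_likelihood_ratio \<sigma> (2 * \<theta>) x \<partial>normal_law \<sigma> 0)
      = emeasure (normal_law \<sigma> (2 * \<theta>)) (space (normal_law \<sigma> (2 * \<theta>)))"
    unfolding normal_law_eq_density[OF assms, of "2 * \<theta>"]
    by (subst emeasure_density) (auto intro!: nn_integral_cong)
  also have "\<dots> = 1"
    using prob_space_normal_law[OF assms] by (rule prob_space.emeasure_space_1)
  finally show ?thesis by simp
qed

text \<open>By independence, the second moment of the likelihood ratio of the sample is the n-th
  power of exp (\<theta>^2/\<sigma>^2).\<close>

lemma normal_sample_law_power2_le:
  assumes "\<sigma> > 0" and A: "A \<in> sets (normal_sample_law \<sigma> 0 n)"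
  shows "(measure (normal_sample_law \<sigma> \<theta> n) A)\<^sup>2
    \<le> measure (normal_sample_law \<sigma> 0 n) A * exp (real n * \<theta>\<^sup>2 / \<sigma>\<^sup>2)"
proof -
  let ?L = "\<lambda>x. ennreal (normal_likelihood_ratio \<sigma> \<theta> x)"
  \<comment> \<open>Stated for every mean because \<open>density_PiM\<close> asks for it before and
    after reweighting, that is, at 0 and at \<theta>.\<close>
  have psf: "product_sigma_finite (\<lambda>i :: nat. normal_law \<sigma> \<mu>)" for \<mu>
    using assms(1) by (auto intro!: product_sigma_finite.intro prob_space_imp_sigma_finite prob_space_normal_law)
  have L: "?L \<in> borel_measurable (normal_law \<sigma> 0)"
    unfolding normal_law_def by measurable
  have eq: "normal_sample_law \<sigma> \<theta> n
      = density (normal_sample_law \<sigma> 0 n) (\<lambda>x. \<Prod>i<n. ?L (x i))"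
    unfolding normal_sample_law_def normal_law_eq_density[OF assms(1), of \<theta>]
    using L psf[of 0] psf[of \<theta>]
    by (intro density_PiM[symmetric]) (auto simp flip: normal_law_eq_density[OF assms(1)])
  have "(emeasure (normal_sample_law \<sigma> \<theta> n) A)\<^sup>2
      \<le> emeasure (normal_sample_law \<sigma> 0 n) A
        * (\<integral>\<^sup>+x. (\<Prod>i<n. ?L (x i))\<^sup>2 \<partial>normal_sample_law \<sigma> 0 n)"
    unfolding eq using A L
    by (intro emeasure_density_power2_le) (auto simp: normal_sample_law_def)
  also have "(\<integral>\<^sup>+x. (\<Prod>i<n. ?L (x i))\<^sup>2 \<partial>normal_sample_law \<sigma> 0 n)
      = (\<Prod>i<n. \<integral>\<^sup>+x. (?L x)\<^sup>2 \<partial>normal_law \<sigma> 0)"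
    unfolding normal_sample_law_def prod_power_distrib
    using L psf by (subst product_sigma_finite.product_nn_integral_prod) auto
  also have "\<dots> = exp (real n * \<theta>\<^sup>2 / \<sigma>\<^sup>2)"
    unfolding nn_integral_normal_likelihood_ratio_power2[OF assms(1)]
    by (simp add: ennreal_power exp_of_nat_mult[symmetric])
  finally have *: "(emeasure (normal_sample_law \<sigma> \<theta> n) A)\<^sup>2
      \<le> emeasure (normal_sample_law \<sigma> 0 n) A * exp (real n * \<theta>\<^sup>2 / \<sigma>\<^sup>2)" .
  interpret P: prob_space "normal_sample_law \<sigma> \<mu> n" for \<mu>
    using assms(1) by (rule prob_space_normal_sample_law)
  show ?thesis
    using * unfolding P.emeasure_eq_measure
    by (simp add: ennreal_power ennreal_mult'[symmetric])
qed

text \<open>The upper limit of the parameter set says exactly that n \<theta>^2/\<sigma>^2 is at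
  most c log (1/d), so the exponential is at most d^(-c). For d = 0 there is no upper limit, but
  both sides vanish, since \<open>0 powr (1 - c)\<close> is 0.\<close>

lemma parameter_set_exp_le:
  assumes "\<sigma> > 0" and "0 < c" and "0 \<le> d" and "d \<le> 1" and "n \<ge> 1" and "\<theta> \<in> parameter_set \<sigma> c d n"
  shows "d * exp (real n * \<theta>\<^sup>2 / \<sigma>\<^sup>2) \<le> d powr (1 - c)"
proof (cases "d = 0")
  case False
  then have "d > 0" using assms by simp
  \<comment> \<open>Here d \<le> 1 enters. The sign matters: squaring \<open>sqrt\<close> of a
    negative number would return its absolute value.\<close>
  have ln: "0 \<le> c * ln (1 / d)"
    using \<open>d > 0\<close> assms by simp
  have "\<theta>\<^sup>2 \<le> (\<sigma> / sqrt (real n) * sqrt (c * ln (1 / d)))\<^sup>2"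
    using assms False unfolding parameter_set_def
    by (intro power2_le_iff_abs_le[THEN iffD2]) auto
  also have "\<dots> = \<sigma>\<^sup>2 / real n * (c * ln (1 / d))"
    using ln by (simp add: power_mult_distrib power_divide)
  finally have "real n * \<theta>\<^sup>2 / \<sigma>\<^sup>2 \<le> c * ln (1 / d)"
    using assms by (simp add: field_simps)
  then have "d * exp (real n * \<theta>\<^sup>2 / \<sigma>\<^sup>2) \<le> exp (ln d) * exp (c * ln (1 / d))"
    using \<open>d > 0\<close> by simp
  also have "\<dots> = d powr (1 - c)"
    unfolding powr_def exp_add[symmetric] using \<open>d > 0\<close> by (simp add: ln_div algebra_simps)
  finally show ?thesis .
qed simp

text \<open>The lower endpoint 2\<sigma>/\<surd>n belongs to the set as soon as c log (1/\<delta>)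
  \<ge> 4 or \<delta> = 0.\<close>

lemma eventually_parameter_set_nonempty:
  assumes "\<sigma> > 0" and "0 < c" and "\<And>n. n \<ge> 1 \<Longrightarrow> 0 \<le> \<delta> n" and "\<delta> \<longlonglongrightarrow> 0"
  shows "eventually (\<lambda>n. parameter_set \<sigma> c (\<delta> n) n \<noteq> {}) sequentially"
proof -
  \<comment> \<open>For positive \<delta> below this threshold, c log (1/\<delta>) exceeds 4, the
    square of the factor 2 in the lower limit.\<close>
  have "eventually (\<lambda>n. \<delta> n < exp (- 4 / c)) sequentially"
    using assms(4) by (rule order_tendstoD) simp
  then show ?thesis using eventually_ge_at_top[of 1]
  proof eventually_elim
    case (elim n)
    have "2 \<le> sqrt (c * ln (1 / \<delta> n))" if "\<delta> n \<noteq> 0"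
    proof -
      have "\<delta> n > 0" using that assms(3)[of n] elim by simp
      then have "ln (\<delta> n) < - 4 / c" using elim
        by (metis exp_ln exp_less_cancel_iff)
      then have "2\<^sup>2 \<le> c * ln (1 / \<delta> n)"
        using \<open>\<delta> n > 0\<close> \<open>0 < c\<close> by (simp add: ln_div field_simps)
      then show ?thesis by (rule real_le_rsqrt)
    qed
    then have "2 * \<sigma> / sqrt (real n) \<in> parameter_set \<sigma> c (\<delta> n) n"
      using assms(1) elim by (auto simp: parameter_set_def field_simps)
    then show ?case by blast
  qed
qed

text \<open>The bound for a single n. Its right-hand side does not involve \<theta>, so it passes to
  the infimum over the parameter set.\<close>

lemma normal_sample_law_error_ge:
  assumes "\<sigma> > 0" and "0 < c" and "0 \<le> d" and "d \<le> 1" and "n \<ge> 1" and "estimator n t"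
    and small: "\<P>(x in normal_sample_law \<sigma> 0 n. \<bar>t x\<bar> \<ge> \<sigma> / sqrt (real n)) \<le> d"
    and \<theta>: "\<theta> \<in> parameter_set \<sigma> c d n"
  shows "\<P>(x in normal_sample_law \<sigma> \<theta> n. sqrt (real n) * \<bar>t x - \<theta>\<bar> \<ge> \<sigma>) \<ge> 1 - sqrt (d powr (1 - c))"
proof -
  interpret P: prob_space "normal_sample_law \<sigma> \<mu> n" for \<mu>
    using assms(1) by (rule prob_space_normal_sample_law)
  have [measurable]: "t \<in> borel_measurable (normal_sample_law \<sigma> \<mu> n)" for \<mu>
    using assms(6) unfolding estimator_def
    by (subst measurable_cong_sets[OF sets_normal_sample_law refl])
  define A where "A = {x \<in> space (normal_sample_law \<sigma> 0 n). \<not> \<sigma> \<le> sqrt (real n) * \<bar>t x - \<theta>\<bar>}"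
  \<comment> \<open>\<open>A\<close> is defined over the sample space of the law at 0; the spaces
    agree, so it is also the event of a small error under \<theta>.\<close>
  have sp: "space (normal_sample_law \<sigma> \<mu> n) = space (normal_sample_law \<sigma> 0 n)" for \<mu>
    by (intro sets_eq_imp_space_eq) (simp add: sets_normal_sample_law)
  have A: "A \<in> sets (normal_sample_law \<sigma> 0 n)"
    unfolding A_def by measurable
  have "A \<subseteq> {x \<in> space (normal_sample_law \<sigma> 0 n). \<bar>t x\<bar> \<ge> \<sigma> / sqrt (real n)}"
  proof (clarsimp simp: A_def)
    fix x assume "\<not> \<sigma> \<le> sqrt (real n) * \<bar>t x - \<theta>\<bar>"
    then have "\<bar>t x - \<theta>\<bar> < \<sigma> / sqrt (real n)"
      using assms(5) by (simp add: field_simps)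
    \<comment> \<open>The factor 2 leaves room for the triangle inequality: \<bar>t x\<bar> \<ge>
      \<bar>\<theta>\<bar> - \<bar>t x - \<theta>\<bar>.\<close>
    moreover have "2 * (\<sigma> / sqrt (real n)) \<le> \<bar>\<theta>\<bar>"
      using \<theta> by (simp add: parameter_set_def)
    ultimately show "\<sigma> / sqrt (real n) \<le> \<bar>t x\<bar>" by linarith
  qed
  then have "P.prob 0 A \<le> d"
    by (intro order_trans[OF P.finite_measure_mono small]) measurable
  then have "P.prob 0 A * exp (real n * \<theta>\<^sup>2 / \<sigma>\<^sup>2) \<le> d powr (1 - c)"
    using parameter_set_exp_le[OF assms(1-5) \<theta>]
    by (meson exp_ge_zero mult_right_mono order_trans)
  with normal_sample_law_power2_le[OF assms(1) A, of \<theta>]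
  have "P.prob \<theta> A \<le> sqrt (d powr (1 - c))"
    by (intro real_le_rsqrt) (rule order_trans)
  moreover have "P.prob \<theta> A = 1 - \<P>(x in normal_sample_law \<sigma> \<theta> n. sqrt (real n) * \<bar>t x - \<theta>\<bar> \<ge> \<sigma>)"
    unfolding A_def sp[symmetric, of \<theta>] by (rule P.prob_neg) measurable
  ultimately show ?thesis by linarith
qed

theorem proposition1:
  fixes \<sigma> c :: real
    and \<delta> :: "nat \<Rightarrow> real"
    and est :: "nat \<Rightarrow> (nat \<Rightarrow> real) \<Rightarrow> real"
  assumes "\<sigma> > 0"
    and "0 < c" and "c < 1"
    and "\<And>n. n \<ge> 1 \<Longrightarrow> 0 \<le> \<delta> n \<and> \<delta> n \<le> 1"
    and "\<delta> \<longlonglongrightarrow> 0"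
    and "\<And>n. n \<ge> 1 \<Longrightarrow> estimator n (est n)"
    and "\<And>n. n \<ge> 1 \<Longrightarrow>
           \<P>(x in normal_sample_law \<sigma> 0 n. \<bar>est n x\<bar> \<ge> \<sigma> / sqrt (real n)) \<le> \<delta> n"
  shows "liminf (\<lambda>n. INF \<theta>\<in>parameter_set \<sigma> c (\<delta> n) n.
           ereal (\<P>(x in normal_sample_law \<sigma> \<theta> n. sqrt (real n) * \<bar>est n x - \<theta>\<bar> \<ge> \<sigma>))) = 1"
    (is "liminf ?f = 1")
proof -
  have nonneg: "0 \<le> \<delta> n" if "n \<ge> 1" for n
    using assms(4)[OF that] ..
  then have ev: "eventually (\<lambda>n. 0 \<le> \<delta> n) sequentially"
    using eventually_sequentially by blast
  \<comment> \<open>Continuity of \<open>powr\<close> at base 0 uses the positive exponent, hence c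
    < 1, and that \<delta> is eventually nonnegative.\<close>
  have "(\<lambda>n. 1 - sqrt (\<delta> n powr (1 - c))) \<longlonglongrightarrow> 1 - sqrt (0 powr (1 - c))"
    using assms(3,5) ev by (intro tendsto_intros) auto
  then have lower: "(\<lambda>n. ereal (1 - sqrt (\<delta> n powr (1 - c)))) \<longlonglongrightarrow> 1"
    by (simp add: one_ereal_def)
  have lower_le: "eventually (\<lambda>n. ereal (1 - sqrt (\<delta> n powr (1 - c))) \<le> ?f n) sequentially"
    using eventually_ge_at_top[of 1]
  proof eventually_elim
    case (elim n)
    show ?case
      using normal_sample_law_error_ge[OF assms(1,2) _ _ elim assms(6,7)[OF elim]] assms(4)[OF elim]
      by (intro INF_greatest) auto
  qed
  \<comment> \<open>In \<open>ereal\<close> the infimum over the empty set is \<infinity>, so the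
    upper bound 1 rests on a member of the set.\<close>
  have "eventually (\<lambda>n. parameter_set \<sigma> c (\<delta> n) n \<noteq> {}) sequentially"
    using assms(1,2) nonneg assms(5) by (rule eventually_parameter_set_nonempty)
  then have le_upper: "eventually (\<lambda>n. ?f n \<le> 1) sequentially"
  proof eventually_elim
    case (elim n)
    then obtain \<theta> where "\<theta> \<in> parameter_set \<sigma> c (\<delta> n) n" by blast
    then show ?case
      by (rule INF_lower2)
        (simp add: one_ereal_def prob_space.prob_le_1[OF prob_space_normal_sample_law[OF assms(1)]])
  qed
  have "?f \<longlonglongrightarrow> 1"
    using lower_le le_upper lower tendsto_const by (rule tendsto_sandwich)
  then show ?thesis by (intro lim_imp_Liminf) simp_all
qed

end
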